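(* For every strongly connected digraph $D$, we have $\chi(D) \le l(D) + 1$, where $l(D)$ denotes the odd circumference of $D$.
   Context: Digraphs are finite and contain no loops and no parallel arcs; a pair of opposite arcs $(u,v)$ and $(v,u)$ is allowed. Cycles in digraphs are simple and directed (no repeated vertices); the length of a cycle is its number of arcs, and $u \to v \to u$ is a directed cycle of length $2$ when both arcs $(u,v)$ and $(v,u)$ are present. The odd circumference $l(D)$ of a digraph $D$ is the length of a longest directed cycle of odd length in $D$, with $l(D) = 1$ if $D$ contains no directed cycle of odd length. The chromatic number $\chi(D)$ of a digraph $D$ is the chromatic number of its underlying undirected graph, i.e. the least number of colors in a coloring of the vertices such that any two vertices joined by an arc (in either direction) receive different colors. *)

theory Defs
  imports "Graph_Theory.Graph_Theory"
begin

definition proper_coloring :: "('a,'b) pre_digraph \<Rightarrow> ('a \<Rightarrow> nat) \<Rightarrow> bool" where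
  "proper_coloring D c \<longleftrightarrow>
     (\<forall>u \<in> verts D. \<forall>v \<in> verts D. (u \<rightarrow>\<^bsub>D\<^esub> v \<or> v \<rightarrow>\<^bsub>D\<^esub> u) \<longrightarrow> c u \<noteq> c v)"

definition colorable :: "('a,'b) pre_digraph \<Rightarrow> nat \<Rightarrow> bool" where
  "colorable D k \<longleftrightarrow> (\<exists>c. proper_coloring D c \<and> c ` verts D \<subseteq> {..<k})"

definition chromatic_number :: "('a,'b) pre_digraph \<Rightarrow> nat" where
  "chromatic_number D = (LEAST k. colorable D k)"

(* Cycles are the library's arc walks, so length p is the number of arcs; in a loopfree
   digraph every cycle has length at least 2, and a pair of opposite arcs is a cycle
   of length 2. *)
definition odd_cycle_lengths :: "('a,'b) pre_digraph \<Rightarrow> nat set" where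
  "odd_cycle_lengths D = {length p | p. pre_digraph.cycle D p \<and> odd (length p)}"

definition odd_circumference :: "('a,'b) pre_digraph \<Rightarrow> nat" where
  "odd_circumference D =
     (if odd_cycle_lengths D = {} then 1 else Max (odd_cycle_lengths D))"

(* For digraphs the minimum and the maximum above are attained. *)

lemma (in digraph) colorable_chromatic_number: "colorable G (chromatic_number G)"
proof -
  obtain c and n :: nat where c: "c ` verts G = {i. i < n}" "inj_on c (verts G)"
    using finite_imp_inj_to_nat_seg[OF finite_verts] by blast
  have "proper_coloring G c"
    unfolding proper_coloring_def using c(2) adj_not_same by (metis inj_onD)
  with c have "colorable G n"
    unfolding colorable_def by auto
  then show ?thesis
    unfolding chromatic_number_def by (rule LeastI)
qed

lemma (in fin_digraph) finite_odd_cycle_lengths: "finite (odd_cycle_lengths G)"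
proof -
  have "length p \<le> card (arcs G)" if "cycle p" for p
  proof -
    have "distinct p" "set p \<subseteq> arcs G"
      using that unfolding cycle_conv by (auto simp: awalk_def)
    then show ?thesis
      by (metis card_mono distinct_card finite_arcs)
  qed
  then have "odd_cycle_lengths G \<subseteq> {..card (arcs G)}"
    unfolding odd_cycle_lengths_def by auto
  then show ?thesis
    by (rule finite_subset) simp
qed

end

theory Submission
  imports Defs
begin

text \<open>
  Let \<open>k\<close> be one more than the odd circumference. Then \<open>k\<close> is even, and a cycle whose length is
  congruent to 1 modulo \<open>k\<close> would be odd and longer than the odd circumference. So it is enough
  that a strongly connected digraph without cycles of length congruent to 1 modulo \<open>k\<close> is
  \<open>k\<close>-colourable; this is \<open>strongly_connected_colorable\<close>.

  For that, label the vertices with integers, to be read modulo \<open>k\<close>, and measure how far the label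
  is from going up by exactly 1 along an arc \<open>e\<close> by the residue
  \<open>(c (head e) - c (tail e) - 1) mod k\<close>, the excess of \<open>e\<close>. The arc is monochromatic if and only if
  its excess is the largest residue, \<open>k - 1\<close>, and it is called tight if its excess is 0. Close each
  arc up to a closed walk, which strong connectivity allows, and choose \<open>c\<close> with the least total
  excess over all these closed walks.

  Suppose that some arc from \<open>u\<close> to \<open>v\<close> is monochromatic. Let \<open>S\<close> be the set of vertices reachable
  from \<open>v\<close> through tight arcs. If \<open>u\<close> is in \<open>S\<close>, then a tight path from \<open>v\<close> to \<open>u\<close> has length
  divisible by \<open>k\<close>, because the label rises by 1 modulo \<open>k\<close> along each of its arcs and its ends have
  the same colour; together with the arc it is a cycle of length congruent to 1 modulo \<open>k\<close>, which is
  excluded. Otherwise raise the labels in \<open>S\<close> by 1. The excess of an arc that leaves \<open>S\<close> was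
  positive and drops by 1. The excess of an arc that enters \<open>S\<close> grows by 1, except that it falls
  from \<open>k - 1\<close> to 0 on a monochromatic arc. A closed walk enters \<open>S\<close> as often as it leaves it, so no
  closed walk gets a larger total excess, while the one through the given monochromatic arc gets a
  smaller one. This contradicts the choice of \<open>c\<close>.
\<close>

definition excess :: "('a,'b) pre_digraph \<Rightarrow> nat \<Rightarrow> ('a \<Rightarrow> int) \<Rightarrow> 'b \<Rightarrow> int" where
  "excess G k c e = (c (head G e) - c (tail G e) - 1) mod int k"

lemma excess_nonneg: "k > 0 \<Longrightarrow> excess G k c e \<ge> 0"
  by (simp add: excess_def)

lemma sum_list_excess_nonneg: "k > 0 \<Longrightarrow> sum_list (map (excess G k c) p) \<ge> 0"
  by (induction p) (simp_all add: excess_nonneg)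

lemma (in pre_digraph) sum_list_head_minus_tail:
  fixes f :: "'a \<Rightarrow> int"
  assumes "cas u p v"
  shows "(\<Sum>e\<leftarrow>p. f (head G e) - f (tail G e)) = f v - f u"
  using assms by (induction p arbitrary: u) auto

lemma (in pre_digraph) dvd_length_of_tight_walk:
  assumes "cas u p v" and "\<And>e. e \<in> set p \<Longrightarrow> excess G k c e = 0"
  shows "int k dvd c v - c u - int (length p)"
  using assms
proof (induction p arbitrary: u)
  case Nil
  then show ?case by simp
next
  case (Cons e p)
  have "int k dvd c v - c (head G e) - int (length p)"
    using Cons by simp
  moreover have "int k dvd c (head G e) - c u - 1"
    using Cons.prems(1) Cons.prems(2)[of e] by (auto simp: excess_def)
  ultimately have "int k dvd (c v - c (head G e) - int (length p)) + (c (head G e) - c u - 1)"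
    by (rule dvd_add)
  then show ?case by (simp add: algebra_simps)
qed

text \<open>
  Raising the labels on a set by 1 costs an arc at most 1 when it enters the set, and gains 1 when it
  leaves. The right-hand side is a difference of a vertex function at the two ends, so that it
  telescopes to 0 on closed walks.
\<close>

lemma excess_raise_le:
  assumes "k > 0" and "\<not> (tail G e \<in> S \<and> head G e \<notin> S \<and> excess G k c e = 0)"
  shows "excess G k (\<lambda>x. c x + of_bool (x \<in> S)) e - excess G k c e
           \<le> of_bool (head G e \<in> S) - of_bool (tail G e \<in> S)"
proof -
  define d where "d = c (head G e) - c (tail G e) - 1"
  have up: "(d + 1) mod int k \<le> d mod int k + 1"
    using assms(1) by (metis mod_add_left_eq pos_mod_sign of_nat_0_less_iff zmod_le_nonneg_dividend
        add_nonneg_nonneg zero_le_one)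
  have down: "(d - 1) mod int k = d mod int k - 1" if "d mod int k \<noteq> 0"
  proof -
    have "0 \<le> d mod int k - 1" "d mod int k - 1 < int k"
      using that assms(1) pos_mod_sign[of "int k" d] pos_mod_bound[of "int k" d] by linarith+
    then show ?thesis by (metis mod_diff_left_eq mod_pos_pos_trivial)
  qed
  show ?thesis
    using assms(2) up down
    by (auto simp: excess_def d_def algebra_simps)
qed

text \<open>
  The gain that drives the argument: an arc whose head alone is raised is allowed an increase of 1
  by \<open>excess_raise_le\<close>, but the excess \<open>k - 1\<close> of a monochromatic arc wraps round to 0 instead.
\<close>

lemma excess_raise_monochromatic:
  assumes "k > 0" and "int k dvd c (head G e) - c (tail G e)"
    and "head G e \<in> S" and "tail G e \<notin> S"
  shows "excess G k (\<lambda>x. c x + of_bool (x \<in> S)) e \<le> excess G k c e"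
  using assms by (simp add: excess_def)

lemma (in pre_digraph) sum_list_excess_raise:
  assumes "k > 0" and "cas w p w"
    and no_tight_exit:
      "\<And>e. e \<in> set p \<Longrightarrow> \<not> (tail G e \<in> S \<and> head G e \<notin> S \<and> excess G k c e = 0)"
  defines "c' \<equiv> \<lambda>x. c x + of_bool (x \<in> S)"
  shows "sum_list (map (excess G k c') p) \<le> sum_list (map (excess G k c) p)"
    and "\<lbrakk>e \<in> set p; int k dvd c (head G e) - c (tail G e); head G e \<in> S; tail G e \<notin> S\<rbrakk>
      \<Longrightarrow> sum_list (map (excess G k c') p) < sum_list (map (excess G k c) p)"
proof -
  define h :: "'b \<Rightarrow> int" where "h a = of_bool (head G a \<in> S) - of_bool (tail G a \<in> S)" for a
  have h0: "sum_list (map h p) = 0"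
    using sum_list_head_minus_tail[OF assms(2), of "\<lambda>x. of_bool (x \<in> S)"]
    by (simp add: h_def[abs_def])
  have le: "excess G k c' a \<le> excess G k c a + h a" if "a \<in> set p" for a
    using excess_raise_le[OF assms(1) no_tight_exit[OF that]] by (simp add: h_def c'_def)
  have split: "(\<Sum>a\<leftarrow>q. excess G k c a + h a) = sum_list (map (excess G k c) q) + sum_list (map h q)"
    for q
    by (rule sum_list_addf)
  show "sum_list (map (excess G k c') p) \<le> sum_list (map (excess G k c) p)"
    using sum_list_mono[of p "excess G k c'" "\<lambda>a. excess G k c a + h a"] le split[of p] h0 by simp
  assume e: "e \<in> set p" "int k dvd c (head G e) - c (tail G e)" "head G e \<in> S" "tail G e \<notin> S"
  have strict: "excess G k c' e < excess G k c e + h e"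
    using excess_raise_monochromatic[OF assms(1) e(2-4)] e(3,4) by (simp add: h_def c'_def)
  obtain q r where p: "p = q @ e # r"
    using e(1) by (meson split_list)
  have "sum_list (map (excess G k c') q) \<le> (\<Sum>a\<leftarrow>q. excess G k c a + h a)"
    and "sum_list (map (excess G k c') r) \<le> (\<Sum>a\<leftarrow>r. excess G k c a + h a)"
    using le p by (auto intro!: sum_list_mono)
  then have "sum_list (map (excess G k c') p) < (\<Sum>a\<leftarrow>p. excess G k c a + h a)"
    using strict p by simp
  then show "sum_list (map (excess G k c') p) < sum_list (map (excess G k c) p)"
    using split[of p] h0 by simp
qed

lemma (in wf_digraph) cycle_Cons_apath:
  assumes "e \<in> arcs G" and "apath (head G e) p (tail G e)"
  shows "cycle (e # p)"
  using assms unfolding cycle_def apath_def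
  by (intro exI[of _ "tail G e"]) (auto simp: awalk_Cons_iff)

text \<open>
  The congruence of cycle lengths to 1 modulo \<open>k\<close> is what the proof meets directly, so the colouring
  is obtained in this form; odd cycles enter only through the choice of \<open>k\<close>.
\<close>

lemma (in fin_digraph) strongly_connected_colorable:
  assumes strong: "strongly_connected G" and k: "k > 0"
    and no_cycle: "\<And>p. cycle p \<Longrightarrow> \<not> k dvd length p - 1"
  shows "colorable G k"
proof -
  have "\<exists>p. cas (tail G e) p (tail G e) \<and> set p \<subseteq> arcs G \<and> e \<in> set p" if e: "e \<in> arcs G" for e
  proof -
    have "head G e \<rightarrow>\<^sup>*\<^bsub>G\<^esub> tail G e"
      using strong e by (auto simp: strongly_connected_def)
    then obtain q where "awalk (head G e) q (tail G e)"
      by (auto simp: reachable_awalk)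
    then show ?thesis
      using e by (intro exI[of _ "e # q"]) (auto simp: awalk_def)
  qed
  then obtain W where W: "\<And>e. e \<in> arcs G \<Longrightarrow> cas (tail G e) (W e) (tail G e)"
      "\<And>e. e \<in> arcs G \<Longrightarrow> set (W e) \<subseteq> arcs G" "\<And>e. e \<in> arcs G \<Longrightarrow> e \<in> set (W e)"
    by metis
  \<comment> \<open>The closed walks \<open>W e\<close> together cover every arc, so that a gain on any arc is seen by \<open>\<Phi>\<close>.\<close>
  define \<Phi> where "\<Phi> c = (\<Sum>e\<in>arcs G. sum_list (map (excess G k c) (W e)))" for c
  have \<Phi>_nonneg: "\<Phi> c \<ge> 0" for c
    unfolding \<Phi>_def by (intro sum_nonneg sum_list_excess_nonneg k)
  obtain c where "\<And>c'. nat (\<Phi> c) \<le> nat (\<Phi> c')"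
    using ex_has_least_nat[of "\<lambda>_. True" _ "\<lambda>c. nat (\<Phi> c)"] by auto
  then have min: "\<Phi> c \<le> \<Phi> c'" for c'
    using \<Phi>_nonneg by (metis nat_le_eq_zle nle_le order.trans)
  have bichromatic: "\<not> int k dvd c (head G e) - c (tail G e)" if e: "e \<in> arcs G" for e
  proof
    assume mono: "int k dvd c (head G e) - c (tail G e)"
    define S where "S = {x. \<exists>p. awalk (head G e) p x \<and> (\<forall>a\<in>set p. excess G k c a = 0)}"
    have head_S: "head G e \<in> S"
      using e unfolding S_def by (auto intro!: exI[of _ "[]"] simp: awalk_Nil_iff)
    have tail_S: "tail G e \<notin> S"
    proof
      assume "tail G e \<in> S"
      then obtain p where p: "awalk (head G e) p (tail G e)" "\<forall>a\<in>set p. excess G k c a = 0"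
        unfolding S_def by auto
      define q where "q = awalk_to_apath p"
      have q: "apath (head G e) q (tail G e)" "\<forall>a\<in>set q. excess G k c a = 0"
        using p apath_awalk_to_apath[OF p(1)] awalk_to_apath_subset[OF p(1)]
        unfolding q_def by auto
      have "int k dvd c (tail G e) - c (head G e) - int (length q)"
        using q by (intro dvd_length_of_tight_walk) (auto simp: apath_def awalk_def)
      then have "int k dvd (c (tail G e) - c (head G e) - int (length q))
          + (c (head G e) - c (tail G e))"
        using mono by (rule dvd_add)
      then have "k dvd length q" by simp
      with no_cycle[OF cycle_Cons_apath[OF e q(1)]] show False by simp
    qed
    have closed: "\<not> (tail G a \<in> S \<and> head G a \<notin> S \<and> excess G k c a = 0)" if a: "a \<in> arcs G" for a
    proof
      assume *: "tail G a \<in> S \<and> head G a \<notin> S \<and> excess G k c a = 0"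
      then obtain p where p: "awalk (head G e) p (tail G a)" "\<forall>b\<in>set p. excess G k c b = 0"
        unfolding S_def by auto
      have "awalk (tail G a) [a] (head G a)"
        using a by (simp add: arc_implies_awalk)
      then have "awalk (head G e) (p @ [a]) (head G a)"
        using p(1) by (rule awalk_appendI[rotated])
      with p(2) * show False
        unfolding S_def by (auto dest!: spec[of _ "p @ [a]"])
    qed
    let ?c' = "\<lambda>x. c x + of_bool (x \<in> S)"
    have "\<Phi> ?c' < \<Phi> c"
      unfolding \<Phi>_def
    proof (rule sum_strict_mono_ex1)
      show "\<forall>a\<in>arcs G. sum_list (map (excess G k ?c') (W a)) \<le> sum_list (map (excess G k c) (W a))"
        using W(2) closed by (intro ballI sum_list_excess_raise(1)[OF k W(1)]) auto
      have "sum_list (map (excess G k ?c') (W e)) < sum_list (map (excess G k c) (W e))"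
        using W(2)[OF e] closed
        by (intro sum_list_excess_raise(2)[OF k W(1)[OF e] _ W(3)[OF e] mono head_S tail_S]) auto
      then show "\<exists>a\<in>arcs G.
          sum_list (map (excess G k ?c') (W a)) < sum_list (map (excess G k c) (W a))"
        using e by blast
    qed simp
    with min[of ?c'] show False by simp
  qed
  define col where "col v = nat (c v mod int k)" for v
  have col_ne: "col (tail G e) \<noteq> col (head G e)" if "e \<in> arcs G" for e
    using bichromatic[OF that] k by (auto simp: col_def nat_eq_iff mod_eq_dvd_iff dvd_diff_commute)
  have "proper_coloring G col"
    unfolding proper_coloring_def using col_ne by (fastforce simp: arcs_ends_conv)
  moreover have "col ` verts G \<subseteq> {..<k}"
    using k by (auto simp: col_def nat_less_iff)
  ultimately show ?thesis
    unfolding colorable_def by blast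
qed

lemma (in fin_digraph) odd_odd_circumference: "odd (odd_circumference G)"
proof (cases "odd_cycle_lengths G = {}")
  case True
  then show ?thesis by (simp add: odd_circumference_def)
next
  case False
  then have "Max (odd_cycle_lengths G) \<in> odd_cycle_lengths G"
    by (intro Max_in finite_odd_cycle_lengths)
  with False show ?thesis
    by (auto simp: odd_circumference_def odd_cycle_lengths_def)
qed

lemma (in fin_digraph) length_le_odd_circumference:
  assumes "cycle p" and "odd (length p)"
  shows "length p \<le> odd_circumference G"
proof -
  have "length p \<in> odd_cycle_lengths G"
    using assms unfolding odd_cycle_lengths_def by blast
  then show ?thesis
    unfolding odd_circumference_def using Max_ge[OF finite_odd_cycle_lengths] by auto
qed

theorem theorem2:
  fixes D :: "('a,'b) pre_digraph"
  assumes "digraph D" and "strongly_connected D"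
  shows "chromatic_number D \<le> odd_circumference D + 1"
proof -
  interpret digraph D by fact
  have "\<not> odd_circumference D + 1 dvd length p - 1" if p: "cycle p" for p
  proof
    assume dvd: "odd_circumference D + 1 dvd length p - 1"
    \<comment> \<open>There are no loops, so \<open>length p - 1\<close> is not 0 and its divisors bound it from below.\<close>
    have "length p \<ge> 2"
      using p by (auto simp: cycle_digraph_conv)
    then have "odd_circumference D + 1 \<le> length p - 1"
      using dvd by (intro dvd_imp_le) auto
    moreover have "even (length p - 1)"
      using dvd odd_odd_circumference by (meson dvd_trans even_plus_one_iff)
    then have "odd (length p)"
      using \<open>length p \<ge> 2\<close> by auto
    then have "length p \<le> odd_circumference D"
      using p by (intro length_le_odd_circumference)
    ultimately show False by simp
  qed
  then have "colorable D (odd_circumference D + 1)"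
    using assms(2) by (intro strongly_connected_colorable) auto
  then show ?thesis
    unfolding chromatic_number_def by (rule Least_le)
qed

end
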